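(* The inequality $c(\mathcal{G})\le\max(c(G),c(G_{\max}))$ does not hold in general: there exists a periodic graph $\mathcal{G}$ with footprint $G$ such that $c(\mathcal{G})>\max(c(G),c(G_{\max}))$.
   Context: All graphs are finite, undirected and reflexive. A periodic graph with period $p\ge1$ is a sequence $\mathcal{G}=(G_0,\dots,G_{p-1})$ of graphs $G_i=(V,E_i)$ on a common vertex set, extended by $G_{i+p}=G_i$; its footprint is $G=(V,\bigcup_iE_i)$, assumed connected. Cops and Robber on a periodic graph with $k$ cops (perfect information): cops choose starting vertices, then the robber; in each round $t=0,1,\dots$ each cop moves to a vertex of $N_{G_{t\bmod p}}[\text{its position}]$, then the robber likewise; the cops win if a cop ever moves onto the robber's vertex. The cop number $c(\cdot)$ is the least $k$ such that $k$ cops have a winning strategy; a static graph is a periodic graph of period $1$. $c(G_{\max})=\max_{0\le i\le p-1}c(G_i)$. *)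

theory Defs
  imports Main
begin

definition reflexive_graph :: "'v set \<Rightarrow> 'v rel \<Rightarrow> bool" where
  "reflexive_graph V E \<longleftrightarrow>
     finite V \<and> V \<noteq> {} \<and> E \<subseteq> V \<times> V \<and> sym E \<and> (\<forall>v\<in>V. (v, v) \<in> E)"

definition connected_graph :: "'v set \<Rightarrow> 'v rel \<Rightarrow> bool" where
  "connected_graph V E \<longleftrightarrow> (\<forall>u\<in>V. \<forall>v\<in>V. (u, v) \<in> E\<^sup>*)"

text \<open>A periodic graph on the vertex set \<open>V\<close> is given by the list of the edge relations of one
  period, so its period is the length of the list and a static graph with edge relation \<open>E\<close> is
  the singleton list \<open>[E]\<close>.\<close>

definition footprint :: "'v rel list \<Rightarrow> 'v rel" where
  "footprint Es = \<Union> (set Es)"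

definition periodic_graph :: "'v set \<Rightarrow> 'v rel list \<Rightarrow> bool" where
  "periodic_graph V Es \<longleftrightarrow>
     length Es \<ge> 1 \<and> (\<forall>i<length Es. reflexive_graph V (Es ! i)) \<and>
     connected_graph V (footprint Es)"

definition snapshot :: "'v rel list \<Rightarrow> nat \<Rightarrow> 'v rel" where
  "snapshot Es t = Es ! (t mod length Es)"

text \<open>In a play, \<open>C t i\<close> and \<open>r t\<close> are the positions of cop \<open>i\<close> and of the robber at the start of
  round \<open>t\<close>. Only the cops \<open>i < k\<close> take part when there are \<open>k\<close> cops.\<close>

type_synonym 'v placement = "nat \<Rightarrow> 'v"

definition legal_cops ::
  "'v set \<Rightarrow> 'v rel list \<Rightarrow> nat \<Rightarrow> (nat \<Rightarrow> 'v placement) \<Rightarrow> bool" where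
  "legal_cops V Es k C \<longleftrightarrow>
     (\<forall>i<k. C 0 i \<in> V \<and> (\<forall>t. (C t i, C (Suc t) i) \<in> snapshot Es t))"

definition legal_robber :: "'v set \<Rightarrow> 'v rel list \<Rightarrow> (nat \<Rightarrow> 'v) \<Rightarrow> bool" where
  "legal_robber V Es r \<longleftrightarrow> r 0 \<in> V \<and> (\<forall>t. (r t, r (Suc t)) \<in> snapshot Es t)"

text \<open>A cop strategy consists of an initial placement \<open>c\<^sub>0\<close>, chosen before the robber's start, and a
  function \<open>\<sigma>\<close> mapping the history of all positions up to the start of a round to the placement
  after the cops' move in that round.\<close>

definition follows_strategy ::
  "'v placement \<Rightarrow> (('v placement \<times> 'v) list \<Rightarrow> 'v placement) \<Rightarrow>
   (nat \<Rightarrow> 'v placement) \<Rightarrow> (nat \<Rightarrow> 'v) \<Rightarrow> bool" where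
  "follows_strategy c\<^sub>0 \<sigma> C r \<longleftrightarrow>
     C 0 = c\<^sub>0 \<and> (\<forall>t. C (Suc t) = \<sigma> (map (\<lambda>s. (C s, r s)) [0..<Suc t]))"

text \<open>Since the cops move first in round \<open>t\<close>, capture means \<open>C (Suc t) i = r t\<close>. A robber stepping
  onto a cop is captured by that cop standing still in the next round. Plays formally continue
  after a capture; this is harmless because all graphs are reflexive.\<close>

definition winning_strategy ::
  "'v set \<Rightarrow> 'v rel list \<Rightarrow> nat \<Rightarrow> 'v placement \<Rightarrow>
   (('v placement \<times> 'v) list \<Rightarrow> 'v placement) \<Rightarrow> bool" where
  "winning_strategy V Es k c\<^sub>0 \<sigma> \<longleftrightarrow>
     (\<forall>C r. legal_robber V Es r \<and> follows_strategy c\<^sub>0 \<sigma> C r \<longrightarrow>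
        legal_cops V Es k C \<and> (\<exists>t. \<exists>i<k. C (Suc t) i = r t))"

definition cops_win :: "'v set \<Rightarrow> 'v rel list \<Rightarrow> nat \<Rightarrow> bool" where
  "cops_win V Es k \<longleftrightarrow> (\<exists>c\<^sub>0 \<sigma>. winning_strategy V Es k c\<^sub>0 \<sigma>)"

definition cop_number :: "'v set \<Rightarrow> 'v rel list \<Rightarrow> nat" where
  "cop_number V Es = (LEAST k. cops_win V Es k)"

definition cop_number_max :: "'v set \<Rightarrow> 'v rel list \<Rightarrow> nat" where
  "cop_number_max V Es = Max ((\<lambda>i. cop_number V [Es ! i]) ` {..<length Es})"

end

theory Submission imports Defs begin

text \<open>The footprint is the wheel with hub \<open>4\<close> and rim \<open>0, 1, 2, 3\<close>. The two snapshots are the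
  Hamiltonian paths \<open>1-0-4-2-3\<close> and \<open>2-1-4-3-0\<close>, which a rotation of the rim exchanges. A single cop
  starting at the hub wins on the wheel and on each of the paths within two rounds. When the paths
  alternate, the robber keeps the pair of positions in a set of safe pairs: from a safe pair the cop
  cannot reach the robber, and to every move of the cop some move of the robber leads to a pair
  that is safe for the other path.\<close>

section \<open>Snapshots and evasion by an invariant\<close>

lemma reflexive_snapshot:
  assumes "periodic_graph V Es"
  shows "reflexive_graph V (snapshot Es t)"
proof -
  have "0 < length Es"
    using assms unfolding periodic_graph_def by linarith
  then show ?thesis
    using assms by (simp add: periodic_graph_def snapshot_def)
qed

lemma snapshot_refl:
  assumes "periodic_graph V Es" "v \<in> V"
  shows "(v, v) \<in> snapshot Es t"
  using reflexive_snapshot[OF assms(1)] assms(2) by (auto simp: reflexive_graph_def)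

lemma snapshot_subset:
  assumes "periodic_graph V Es" "(u, v) \<in> snapshot Es t"
  shows "v \<in> V"
  using reflexive_snapshot[OF assms(1)] assms(2) by (auto simp: reflexive_graph_def)

lemma snapshot_static [simp]: "snapshot [E] t = E"
  by (simp add: snapshot_def)

text \<open>\<open>\<sigma>\<close> reads the whole history, so the play against it is built as a
  growing list. The answer \<open>\<rho>\<close> sees only the round, the cops' new placement and
  the robber's vertex, which suffices for a positional invariant.\<close>

fun robber_play ::
  "(('v placement \<times> 'v) list \<Rightarrow> 'v placement) \<Rightarrow> (nat \<Rightarrow> 'v placement \<Rightarrow> 'v \<Rightarrow> 'v) \<Rightarrow>
   'v placement \<Rightarrow> 'v \<Rightarrow> nat \<Rightarrow> ('v placement \<times> 'v) list" where
  "robber_play \<sigma> \<rho> c r 0 = [(c, r)]"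
| "robber_play \<sigma> \<rho> c r (Suc t) =
     (let h = robber_play \<sigma> \<rho> c r t in h @ [(\<sigma> h, \<rho> t (\<sigma> h) (snd (last h)))])"

text \<open>Positions are read off as the last entries of the histories; this returns them to the
  form of history that \<open>follows_strategy\<close> passes to \<open>\<sigma>\<close>.\<close>

lemma map_last_robber_play:
  "map (\<lambda>s. last (robber_play \<sigma> \<rho> c r s)) [0..<Suc t] = robber_play \<sigma> \<rho> c r t"
  by (induction t) (simp_all add: Let_def)

text \<open>\<open>safe\<close> is an invariant at the start of each round. A robber who always
  answers back into it is never met, so every alleged winning strategy loses a play.\<close>

lemma not_cops_winI:
  assumes per: "periodic_graph V Es"
    and start: "\<And>c. (\<And>i. i < k \<Longrightarrow> c i \<in> V) \<Longrightarrow> \<exists>r\<in>V. safe 0 c r"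
    and step: "\<And>t c c' r. safe t c r \<Longrightarrow> (\<And>i. i < k \<Longrightarrow> (c i, c' i) \<in> snapshot Es t) \<Longrightarrow>
      (\<forall>i<k. c' i \<noteq> r) \<and> (\<exists>r'. (r, r') \<in> snapshot Es t \<and> safe (Suc t) c' r')"
  shows "\<not> cops_win V Es k"
proof
  assume "cops_win V Es k"
  then obtain c\<^sub>0 \<sigma> where win: "winning_strategy V Es k c\<^sub>0 \<sigma>"
    by (auto simp: cops_win_def)
  \<comment> \<open>Legality of \<open>c\<^sub>0\<close> follows from the winning strategy only once
    a complete play is at hand, while \<open>r\<^sub>0\<close> is needed to build that play. Hence
    safety is conditional here and is discharged later from \<open>legal\<close>.\<close>
  obtain r\<^sub>0 where r0: "r\<^sub>0 \<in> V" and r0_safe: "(\<And>i. i < k \<Longrightarrow> c\<^sub>0 i \<in> V) \<Longrightarrow> safe 0 c\<^sub>0 r\<^sub>0"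
  proof (cases "\<forall>i<k. c\<^sub>0 i \<in> V")
    case True
    then show ?thesis using start that by blast
  next
    case False
    have "V \<noteq> {}" using reflexive_snapshot[OF per] by (simp add: reflexive_graph_def)
    then show ?thesis using False that by blast
  qed
  \<comment> \<open>Standing still is a legal default answer, so the play is legal whatever the cops do.\<close>
  define \<rho> where "\<rho> t c r =
    (if \<exists>r'. (r, r') \<in> snapshot Es t \<and> safe (Suc t) c r'
     then SOME r'. (r, r') \<in> snapshot Es t \<and> safe (Suc t) c r' else r)" for t c r
  have \<rho>_legal: "(r, \<rho> t c r) \<in> snapshot Es t" if "r \<in> V" for t c r
  proof (cases "\<exists>r'. (r, r') \<in> snapshot Es t \<and> safe (Suc t) c r'")
    case True
    from someI_ex[OF this] True show ?thesis by (simp add: \<rho>_def)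
  next
    case False
    then show ?thesis using snapshot_refl[OF per that] unfolding \<rho>_def by (simp only: if_False)
  qed
  have \<rho>_safe: "safe (Suc t) c (\<rho> t c r)"
    if "\<exists>r'. (r, r') \<in> snapshot Es t \<and> safe (Suc t) c r'" for t c r
    using someI_ex[OF that] that by (simp add: \<rho>_def)
  define H where "H = robber_play \<sigma> \<rho> c\<^sub>0 r\<^sub>0"
  define C where "C t = fst (last (H t))" for t
  define r where "r t = snd (last (H t))" for t
  have H: "map (\<lambda>s. (C s, r s)) [0..<Suc t] = H t" for t
    using map_last_robber_play[of \<sigma> \<rho> c\<^sub>0 r\<^sub>0 t] by (simp add: C_def r_def H_def)
  have C_Suc: "C (Suc t) = \<sigma> (H t)" and r_Suc: "r (Suc t) = \<rho> t (C (Suc t)) (r t)" for t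
    by (simp_all add: C_def r_def H_def Let_def)
  have C_0: "C 0 = c\<^sub>0" and r_0: "r 0 = r\<^sub>0"
    by (simp_all add: C_def r_def H_def)
  have r_in: "r t \<in> V" for t
    using snapshot_subset[OF per \<rho>_legal] by (induction t) (auto simp: r_0 r0 r_Suc)
  have "legal_robber V Es r"
    using r_in \<rho>_legal by (simp add: legal_robber_def r_Suc)
  moreover have "follows_strategy c\<^sub>0 \<sigma> C r"
    unfolding follows_strategy_def H by (simp add: C_0 C_Suc)
  ultimately have legal: "legal_cops V Es k C" and caught: "\<exists>t. \<exists>i<k. C (Suc t) i = r t"
    using win by (auto simp: winning_strategy_def)
  have C_step: "(C t i, C (Suc t) i) \<in> snapshot Es t" if "i < k" for t i
    using legal that by (simp add: legal_cops_def)
  have safe: "safe t (C t) (r t)" for t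
  proof (induction t)
    case 0
    then show ?case
      using legal r0_safe by (simp add: C_0 r_0 legal_cops_def)
  next
    case (Suc t)
    then show ?case
      using step[OF Suc C_step] \<rho>_safe by (simp add: r_Suc)
  qed
  show False
    using caught step[OF safe C_step] by blast
qed

section \<open>Bounds on cop numbers\<close>

lemma not_cops_win_0:
  assumes "periodic_graph V Es"
  shows "\<not> cops_win V Es 0"
proof (rule not_cops_winI[OF assms, where safe = "\<lambda>t c r. r \<in> V"])
  show "\<exists>r\<in>V. r \<in> V"
    using reflexive_snapshot[OF assms, of 0] by (auto simp: reflexive_graph_def)
qed (auto intro: snapshot_refl[OF assms])

text \<open>A motionless cop on every vertex captures in round 0. This guarantees that the
  \<open>LEAST\<close> in \<open>cop_number\<close> is attained.\<close>

lemma cops_win_card: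
  assumes per: "periodic_graph V Es"
  shows "cops_win V Es (card V)"
proof -
  have "finite V"
    using reflexive_snapshot[OF per] by (simp add: reflexive_graph_def)
  then obtain c where c: "bij_betw c {0..<card V} V"
    using ex_bij_betw_nat_finite by blast
  have "legal_cops V Es (card V) C \<and> (\<exists>t. \<exists>i<card V. C (Suc t) i = r t)"
    if r: "legal_robber V Es r" and C: "follows_strategy c (\<lambda>_. c) C r" for C r
  proof
    have C_eq: "C t = c" for t
      using C by (cases t) (auto simp: follows_strategy_def)
    show "legal_cops V Es (card V) C"
      using c snapshot_refl[OF per] by (auto simp: legal_cops_def C_eq dest: bij_betw_apply)
    have "r 0 \<in> c ` {0..<card V}"
      using r c by (simp add: legal_robber_def bij_betw_imp_surj_on)
    then obtain i where "i < card V" "r 0 = c i"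
      by auto
    then show "\<exists>t. \<exists>i<card V. C (Suc t) i = r t"
      unfolding C_eq by metis
  qed
  then show ?thesis
    unfolding cops_win_def winning_strategy_def by blast
qed

lemma cop_number_gt_1:
  assumes "periodic_graph V Es" "\<not> cops_win V Es 1"
  shows "1 < cop_number V Es"
proof -
  have "cops_win V Es (cop_number V Es)"
    unfolding cop_number_def by (rule LeastI, rule cops_win_card[OF assms(1)])
  then have "cop_number V Es \<noteq> 0" "cop_number V Es \<noteq> 1"
    using not_cops_win_0[OF assms(1)] assms(2) by metis+
  then show ?thesis by linarith
qed

text \<open>From \<open>s\<close> the cop moves to a vertex whose closed neighbourhood contains that
  of the robber. Wherever the robber goes next, the cop is adjacent and captures in round 1.\<close>

lemma cop_number_static_le_1:
  assumes E: "reflexive_graph V E" and s: "s \<in> V"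
    and corner: "\<And>r. r \<in> V \<Longrightarrow> \<exists>c. (s, c) \<in> E \<and> E `` {r} \<subseteq> E `` {c}"
  shows "cop_number V [E] \<le> 1"
proof -
  obtain f where f: "(s, f r) \<in> E" "E `` {r} \<subseteq> E `` {f r}" if "r \<in> V" for r
    using corner by metis
  \<comment> \<open>In round t the history has length t + 1, so lengths 1 and 2 are the dominating
    move and the capture. Afterwards the cop rests, since legality is required in all later rounds
    too.\<close>
  define \<sigma> :: "('a placement \<times> 'a) list \<Rightarrow> 'a placement" where
    "\<sigma> h = (if length h = 1 then (\<lambda>_. f (snd (last h)))
            else if length h = 2 then (\<lambda>_. snd (last h)) else fst (last h))" for h
  have "legal_cops V [E] 1 C \<and> (\<exists>t. \<exists>i<1. C (Suc t) i = r t)"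
    if r: "legal_robber V [E] r" and C: "follows_strategy (\<lambda>_. s) \<sigma> C r" for C r
  proof
    have C_0: "C 0 = (\<lambda>_. s)" and C_Suc: "C (Suc t) = \<sigma> (map (\<lambda>s. (C s, r s)) [0..<Suc t])" for t
      using C by (auto simp: follows_strategy_def)
    have C_1: "C (Suc 0) = (\<lambda>_. f (r 0))" and C_2: "C (Suc (Suc 0)) = (\<lambda>_. r (Suc 0))"
      by (simp_all add: C_Suc \<sigma>_def)
    have C_later: "C (Suc (Suc (Suc t))) = C (Suc (Suc t))" for t
      by (subst C_Suc) (simp add: \<sigma>_def)
    have r_V: "r 0 \<in> V" and r_E: "(r t, r (Suc t)) \<in> E" for t
      using r by (auto simp: legal_robber_def)
    have "(C t 0, C (Suc t) 0) \<in> E" for t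
    proof -
      consider "t = 0" | "t = Suc 0" | u where "t = Suc (Suc u)"
        by (metis not0_implies_Suc)
      then show ?thesis
      proof cases
        case 1
        then show ?thesis using f(1)[OF r_V] by (simp add: C_0 C_1)
      next
        case 2
        then show ?thesis using f(2)[OF r_V] r_E[of 0] by (auto simp: C_1 C_2)
      next
        case (3 u)
        have "C (Suc (Suc u)) 0 = r (Suc 0)"
          by (induction u) (simp_all add: C_2 C_later)
        then show ?thesis
          using E r_E[of 0] by (auto simp: 3 C_later reflexive_graph_def)
      qed
    qed
    then show "legal_cops V [E] 1 C"
      using s by (simp add: legal_cops_def C_0)
    show "\<exists>t. \<exists>i<1. C (Suc t) i = r t"
      by (rule exI[of _ "Suc 0"]) (simp add: C_2)
  qed
  then have "cops_win V [E] 1"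
    unfolding cops_win_def winning_strategy_def by blast
  then show ?thesis
    by (simp add: cop_number_def Least_le)
qed

section \<open>The wheel and its two alternating paths\<close>

definition wheel_vertices :: "nat set" where
  "wheel_vertices = {0, 1, 2, 3, 4}"

definition reflexive_closure :: "nat rel \<Rightarrow> nat rel" where
  "reflexive_closure A = Id_on wheel_vertices \<union> A \<union> A\<inverse>"

definition path_0 :: "nat rel" where
  "path_0 = reflexive_closure {(1, 0), (0, 4), (4, 2), (2, 3)}"

definition path_1 :: "nat rel" where
  "path_1 = reflexive_closure {(2, 1), (1, 4), (4, 3), (3, 0)}"

text \<open>Pairs of a cop and a robber position, at the start of an even and of an odd round
  respectively, that form the greatest solution of the robber's evasion condition. Rotating the
  rim by one step exchanges the two sets.\<close>

definition safe_0 :: "nat rel" where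
  "safe_0 = {(0,2), (0,3), (1,2), (1,3), (1,4), (2,0), (2,1), (3,0), (3,1), (3,4), (4,1), (4,3)}"

definition safe_1 :: "nat rel" where
  "safe_1 = {(0,1), (0,2), (0,4), (1,0), (1,3), (2,0), (2,3), (2,4), (3,1), (3,2), (4,0), (4,2)}"

lemmas wheel_defs = wheel_vertices_def reflexive_closure_def path_0_def path_1_def

text \<open>Listing the pairs lets the simplifier decide quantifiers bounded by the edge relation by
  plain enumeration.\<close>

lemma path_0_eq:
  "path_0 = {(0,0), (1,1), (2,2), (3,3), (4,4), (1,0), (0,1), (0,4), (4,0),
     (4,2), (2,4), (2,3), (3,2)}"
  by (auto simp: wheel_defs)

lemma path_1_eq:
  "path_1 = {(0,0), (1,1), (2,2), (3,3), (4,4), (2,1), (1,2), (1,4), (4,1),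
     (4,3), (3,4), (3,0), (0,3)}"
  by (auto simp: wheel_defs)

lemma safe_0_step:
  assumes "(c, r) \<in> safe_0" "(c, c') \<in> path_0"
  shows "c' \<noteq> r \<and> (\<exists>r'. (r, r') \<in> path_0 \<and> (c', r') \<in> safe_1)"
proof -
  \<comment> \<open>All quantifiers range over listed sets of pairs, with equations such as
    \<open>d = c\<close> selecting the relevant edges, so the claim unfolds into a finite
    check.\<close>
  have "\<forall>(c, r)\<in>safe_0. \<forall>(d, c')\<in>path_0. d = c \<longrightarrow>
      c' \<noteq> r \<and> (\<exists>(q, r')\<in>path_0. q = r \<and> (c', r') \<in> safe_1)"
    by (simp add: path_0_eq safe_0_def safe_1_def)
  from bspec[OF bspec[OF this assms(1), simplified] assms(2)] show ?thesis by auto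
qed

lemma safe_1_step:
  assumes "(c, r) \<in> safe_1" "(c, c') \<in> path_1"
  shows "c' \<noteq> r \<and> (\<exists>r'. (r, r') \<in> path_1 \<and> (c', r') \<in> safe_0)"
proof -
  have "\<forall>(c, r)\<in>safe_1. \<forall>(d, c')\<in>path_1. d = c \<longrightarrow>
      c' \<noteq> r \<and> (\<exists>(q, r')\<in>path_1. q = r \<and> (c', r') \<in> safe_0)"
    by (simp add: path_1_eq safe_0_def safe_1_def)
  from bspec[OF bspec[OF this assms(1), simplified] assms(2)] show ?thesis by auto
qed

lemma reflexive_graph_closure:
  assumes "A \<subseteq> wheel_vertices \<times> wheel_vertices"
  shows "reflexive_graph wheel_vertices (reflexive_closure A)"
proof -
  have "finite wheel_vertices" "wheel_vertices \<noteq> {}"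
    by (simp_all add: wheel_vertices_def)
  then show ?thesis
    using assms unfolding reflexive_graph_def reflexive_closure_def sym_def by blast
qed

lemma reflexive_paths:
  "reflexive_graph wheel_vertices path_0" "reflexive_graph wheel_vertices path_1"
  unfolding path_0_def path_1_def
  by (rule reflexive_graph_closure; simp add: wheel_vertices_def)+

lemma reflexive_wheel: "reflexive_graph wheel_vertices (footprint [path_0, path_1])"
  using reflexive_paths by (auto simp: reflexive_graph_def footprint_def intro: sym_Un)

lemma hub_universal:
  assumes "v \<in> wheel_vertices"
  shows "(4, v) \<in> footprint [path_0, path_1]"
  using assms by (auto simp: footprint_def wheel_defs)

lemma periodic_wheel: "periodic_graph wheel_vertices [path_0, path_1]"
proof -
  have "(u, v) \<in> (footprint [path_0, path_1])\<^sup>*"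
    if "u \<in> wheel_vertices" "v \<in> wheel_vertices" for u v
  proof -
    have "(u, 4) \<in> footprint [path_0, path_1]"
      using hub_universal[OF that(1)] reflexive_wheel by (auto simp: reflexive_graph_def sym_def)
    then show ?thesis
      using hub_universal[OF that(2)] by (meson r_into_rtrancl rtrancl_into_rtrancl)
  qed
  then show ?thesis
    using reflexive_paths
    by (auto simp: periodic_graph_def connected_graph_def nth_Cons split: nat.split)
qed

lemma not_cops_win_wheel: "\<not> cops_win wheel_vertices [path_0, path_1] 1"
proof (rule not_cops_winI[OF periodic_wheel,
    where safe = "\<lambda>t c r. (c 0, r) \<in> (if even t then safe_0 else safe_1)"])
  fix c :: "nat placement"
  assume "\<And>i. i < 1 \<Longrightarrow> c i \<in> wheel_vertices"
  then have "c 0 \<in> wheel_vertices" by simp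
  \<comment> \<open>Each of the five vertices occurs as a first component in
    \<open>safe_0\<close>.\<close>
  then show "\<exists>r\<in>wheel_vertices. (c 0, r) \<in> (if even (0::nat) then safe_0 else safe_1)"
    by (auto simp: wheel_vertices_def safe_0_def)
next
  fix t :: nat and c c' :: "nat placement" and r
  assume safe: "(c 0, r) \<in> (if even t then safe_0 else safe_1)"
    and "\<And>i. i < 1 \<Longrightarrow> (c i, c' i) \<in> snapshot [path_0, path_1] t"
  then have move: "(c 0, c' 0) \<in> snapshot [path_0, path_1] t" by simp
  \<comment> \<open>The length evaluates to \<open>Suc (Suc 0)\<close>; flipping
    \<open>numeral_2_eq_2\<close> restores the \<open>t mod 2\<close> that \<open>mod2_eq_if\<close>
    rewrites.\<close>
  have snap: "snapshot [path_0, path_1] t = (if even t then path_0 else path_1)"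
    by (simp add: snapshot_def mod2_eq_if flip: numeral_2_eq_2)
  have "c' 0 \<noteq> r \<and> (\<exists>r'. (r, r') \<in> snapshot [path_0, path_1] t \<and>
      (c' 0, r') \<in> (if even (Suc t) then safe_0 else safe_1))"
  proof (cases "even t")
    case True
    then show ?thesis
      using safe_0_step[of "c 0" r "c' 0"] safe move by (simp add: snap)
  next
    case False
    then show ?thesis
      using safe_1_step[of "c 0" r "c' 0"] safe move by (simp add: snap)
  qed
  then show "(\<forall>i<1. c' i \<noteq> r) \<and> (\<exists>r'. (r, r') \<in> snapshot [path_0, path_1] t \<and>
      (c' 0, r') \<in> (if even (Suc t) then safe_0 else safe_1))"
    by simp
qed

text \<open>The hub is the middle of the path. Each end is dominated by its neighbour and every
  other vertex by itself, and these dominating vertices lie within one step of the hub.\<close>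

lemma cop_number_path_0: "cop_number wheel_vertices [path_0] \<le> 1"
proof (rule cop_number_static_le_1[OF reflexive_paths(1), of 4])
  fix r
  assume r: "r \<in> wheel_vertices"
  have "\<forall>r\<in>wheel_vertices. \<exists>(h, c)\<in>path_0. h = 4 \<and>
      (\<forall>(q, r')\<in>path_0. q = r \<longrightarrow> (c, r') \<in> path_0)"
    by (simp add: path_0_eq wheel_vertices_def)
  from bspec[OF this r] show "\<exists>c. (4, c) \<in> path_0 \<and> path_0 `` {r} \<subseteq> path_0 `` {c}"
    by blast
qed (simp add: wheel_vertices_def)

lemma cop_number_path_1: "cop_number wheel_vertices [path_1] \<le> 1"
proof (rule cop_number_static_le_1[OF reflexive_paths(2), of 4])
  fix r
  assume r: "r \<in> wheel_vertices"
  have "\<forall>r\<in>wheel_vertices. \<exists>(h, c)\<in>path_1. h = 4 \<and>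
      (\<forall>(q, r')\<in>path_1. q = r \<longrightarrow> (c, r') \<in> path_1)"
    by (simp add: path_1_eq wheel_vertices_def)
  from bspec[OF this r] show "\<exists>c. (4, c) \<in> path_1 \<and> path_1 `` {r} \<subseteq> path_1 `` {c}"
    by blast
qed (simp add: wheel_vertices_def)

text \<open>The cop waits at the hub, which dominates every vertex.\<close>

lemma cop_number_wheel: "cop_number wheel_vertices [footprint [path_0, path_1]] \<le> 1"
proof (rule cop_number_static_le_1[OF reflexive_wheel, of 4])
  fix r
  have "footprint [path_0, path_1] `` {r} \<subseteq> wheel_vertices"
    using reflexive_wheel unfolding reflexive_graph_def by blast
  also have "\<dots> \<subseteq> footprint [path_0, path_1] `` {4}"
    using hub_universal by blast
  finally show "\<exists>c. (4, c) \<in> footprint [path_0, path_1] \<and>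
      footprint [path_0, path_1] `` {r} \<subseteq> footprint [path_0, path_1] `` {c}"
    using hub_universal[of 4] by (auto simp: wheel_vertices_def)
qed (simp add: wheel_vertices_def)

theorem theorem4:
  "\<exists>(V :: nat set) Es. periodic_graph V Es \<and>
     cop_number V Es > max (cop_number V [footprint Es]) (cop_number_max V Es)"
proof (intro exI conjI)
  have "cop_number_max wheel_vertices [path_0, path_1] \<le> 1"
    using cop_number_path_0 cop_number_path_1 by (simp add: cop_number_max_def lessThan_Suc)
  then show "cop_number wheel_vertices [path_0, path_1] >
      max (cop_number wheel_vertices [footprint [path_0, path_1]])
        (cop_number_max wheel_vertices [path_0, path_1])"
    using cop_number_wheel cop_number_gt_1[OF periodic_wheel not_cops_win_wheel] by simp
qed (rule periodic_wheel)

end
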